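(* Let $\mathbf{k}$ be a field of characteristic $0$ and let $(A,\mu,\alpha)$ be a multiplicative up to $(n-1)$st Hom-power associative algebra over $\mathbf{k}$ for some $n\ge 4$. Then $$[\alpha^{\lambda-1}(x^{n-\lambda}),\,\alpha^{n-\lambda-1}(x^\lambda)]=0$$ for all $x\in A$ and $\lambda\in\{1,\dots,n-1\}$, where $[a,b]=ab-ba$ is the commutator.
   Context: A Hom-algebra $(A,\mu,\alpha)$ over $\mathbf{k}$ is a $\mathbf{k}$-vector space $A$ with a bilinear map $\mu\colon A^{\otimes 2}\to A$ (no associativity assumed; write $xy=\mu(x,y)$) and a linear map $\alpha\colon A\to A$. It is multiplicative if $\alpha(xy)=\alpha(x)\alpha(y)$ for all $x,y$. Here $\alpha^m$ is the $m$-fold composition, $\alpha^0=Id$. Hom-powers: $x^1=x$ and $x^m=x^{m-1}\alpha^{m-2}(x)$ for $m\ge 2$. $A$ is $m$th Hom-power associative if $x^m=\alpha^{m-i-1}(x^i)\,\alpha^{i-1}(x^{m-i})$ for all $x\in A$ and $i\in\{1,\dots,m-1\}$; it is up to $m$th Hom-power associative if it is $k$th Hom-power associative for all $k\in\{2,\dots,m\}$. *)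

theory Defs
  imports Complex_Main
begin

locale hom_algebra = vector_space scale
  for scale :: "'k::field \<Rightarrow> 'a::ab_group_add \<Rightarrow> 'a" +
  fixes \<mu> :: "'a \<Rightarrow> 'a \<Rightarrow> 'a" and \<alpha> :: "'a \<Rightarrow> 'a"
  assumes mu_linear_left: "Vector_Spaces.linear scale scale (\<lambda>x. \<mu> x y)"
    and mu_linear_right: "Vector_Spaces.linear scale scale (\<lambda>y. \<mu> x y)"
    and alpha_linear: "Vector_Spaces.linear scale scale \<alpha>"

locale multiplicative_hom_algebra = hom_algebra scale \<mu> \<alpha>
  for scale :: "'k::field \<Rightarrow> 'a::ab_group_add \<Rightarrow> 'a" and \<mu> \<alpha> +
  assumes alpha_mult: "\<alpha> (\<mu> x y) = \<mu> (\<alpha> x) (\<alpha> y)"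

text \<open>Hom-powers are only meaningful for exponents at least 1; the value at exponent 0 is a
  dummy.\<close>

fun hom_power :: "('a \<Rightarrow> 'a \<Rightarrow> 'a) \<Rightarrow> ('a \<Rightarrow> 'a) \<Rightarrow> 'a \<Rightarrow> nat \<Rightarrow> 'a" where
  "hom_power \<mu> \<alpha> x 0 = undefined"
| "hom_power \<mu> \<alpha> x (Suc 0) = x"
| "hom_power \<mu> \<alpha> x (Suc (Suc m)) = \<mu> (hom_power \<mu> \<alpha> x (Suc m)) ((\<alpha> ^^ m) x)"

definition hom_power_associative :: "('a \<Rightarrow> 'a \<Rightarrow> 'a) \<Rightarrow> ('a \<Rightarrow> 'a) \<Rightarrow> nat \<Rightarrow> bool" where
  "hom_power_associative \<mu> \<alpha> m \<longleftrightarrow>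
     (\<forall>x. \<forall>i\<in>{1..m-1}. hom_power \<mu> \<alpha> x m =
        \<mu> ((\<alpha> ^^ (m-i-1)) (hom_power \<mu> \<alpha> x i)) ((\<alpha> ^^ (i-1)) (hom_power \<mu> \<alpha> x (m-i))))"

definition up_to_hom_power_associative :: "('a \<Rightarrow> 'a \<Rightarrow> 'a) \<Rightarrow> ('a \<Rightarrow> 'a) \<Rightarrow> nat \<Rightarrow> bool" where
  "up_to_hom_power_associative \<mu> \<alpha> m \<longleftrightarrow> (\<forall>k\<in>{2..m}. hom_power_associative \<mu> \<alpha> k)"

definition commutator :: "('a \<Rightarrow> 'a \<Rightarrow> 'a::ab_group_add) \<Rightarrow> 'a \<Rightarrow> 'a \<Rightarrow> 'a" where
  "commutator \<mu> a b = \<mu> a b - \<mu> b a"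

end

theory Submission
  imports Defs
begin

text \<open>
  Write \<open>c l\<close> for the commutator of \<open>\<alpha>^(l-1)(x^(n-l))\<close> and \<open>\<alpha>^(n-l-1)(x^l)\<close>. The idea is to
  linearise identities of lower degree in a direction that raises the total degree to exactly \<open>n\<close>.

  Hom-power associativity in degree \<open>m < n\<close>, used for the two extreme splittings of \<open>m\<close>,
  says that \<open>z^(m-1)\<close> commutes with \<open>\<alpha>^(m-2)(z)\<close> for every \<open>z\<close>. Substitute \<open>z + t y\<close> with
  \<open>z = \<alpha>^(l-1)(x)\<close>, \<open>y = x^l\<close> and \<open>m = n - l + 1\<close>, and compare coefficients of \<open>t\<close>, which is
  legitimate over an infinite field. The powers of \<open>\<alpha>\<close> are such that \<open>y\<close> fits into every
  position occupied by \<open>z\<close>: the derivative of \<open>z^k\<close> in the direction \<open>y\<close> is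
  \<open>k x^(k+l-1)\<close> as long as \<open>k + l - 1 < n\<close> (\<open>power_jet\<close>). The linear coefficient therefore reads
  \<open>(n - l) c 1 + c l = 0\<close> for \<open>l \<ge> 2\<close> (\<open>linearized_commutation\<close>).

  Since \<open>c\<close> is antisymmetric under \<open>l \<mapsto> n - l\<close>, the instances \<open>l = 2\<close> and \<open>l = n - 2\<close> add up to
  \<open>n c 1 = 0\<close>. They exist because \<open>n \<ge> 4\<close>. In characteristic zero this kills \<open>c 1\<close>, and with
  it every \<open>c l\<close>.
\<close>

section \<open>Polynomial curves and their first-order jets\<close>

locale char_0_space = vector_space scale
  for scale :: "'k::field_char_0 \<Rightarrow> 'a::ab_group_add \<Rightarrow> 'a"
begin

text \<open>These are the \<open>A\<close>-valued polynomials in one scalar variable. Generating them by closure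
  rules makes stability under linear and bilinear maps a plain induction; coefficients are
  needed only to show that they vanish.\<close>

inductive poly_curve :: "('k \<Rightarrow> 'a) \<Rightarrow> bool" where
  const: "poly_curve (\<lambda>t. c)"
| add: "poly_curve f \<Longrightarrow> poly_curve g \<Longrightarrow> poly_curve (\<lambda>t. f t + g t)"
| shift: "poly_curve f \<Longrightarrow> poly_curve (\<lambda>t. scale t (f t))"

lemma poly_curve_linear:
  assumes "Vector_Spaces.linear scale scale L" "poly_curve f"
  shows "poly_curve (\<lambda>t. L (f t))"
  using assms(2)
proof induction
  case (const c)
  show ?case by (rule poly_curve.const)
next
  case (add f g)
  then show ?case
    using assms(1) poly_curve.add[of "\<lambda>t. L (f t)"] by (simp add: Vector_Spaces.linear_iff)
next
  case (shift f)
  then show ?case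
    using assms(1) poly_curve.shift[of "\<lambda>t. L (f t)"] by (simp add: Vector_Spaces.linear_iff)
qed

lemma poly_curve_bilinear:
  assumes left: "\<And>y. Vector_Spaces.linear scale scale (\<lambda>x. B x y)"
    and right: "\<And>x. Vector_Spaces.linear scale scale (\<lambda>y. B x y)"
    and "poly_curve f" "poly_curve g"
  shows "poly_curve (\<lambda>t. B (f t) (g t))"
  using assms(3)
proof induction
  case (const c)
  show ?case by (rule poly_curve_linear[OF right assms(4)])
next
  case (add f h)
  then show ?case
    using left poly_curve.add[of "\<lambda>t. B (f t) (g t)"] by (simp add: Vector_Spaces.linear_iff)
next
  case (shift f)
  then show ?case
    using left poly_curve.shift[of "\<lambda>t. B (f t) (g t)"] by (simp add: Vector_Spaces.linear_iff)
qed

lemma poly_curve_coefficients: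
  assumes "poly_curve f"
  shows "\<exists>d v. \<forall>t. f t = (\<Sum>i<d. scale (t ^ i) (v i))"
  using assms
proof induction
  case (const c)
  have "\<forall>t::'k. c = (\<Sum>i<Suc 0. scale (t ^ i) c)" by simp
  then show ?case by (intro exI[of _ "Suc 0"] exI[of _ "\<lambda>_. c"])
next
  case (add f g)
  then obtain d v e w where f: "\<And>t. f t = (\<Sum>i<d. scale (t ^ i) (v i))"
    and g: "\<And>t. g t = (\<Sum>i<e. scale (t ^ i) (w i))"
    by blast
  have pad: "(\<Sum>i<d. scale (t ^ i) (v i))
      = (\<Sum>i<max d e. scale (t ^ i) (if i < d then v i else 0))"
    for d e :: nat and v :: "nat \<Rightarrow> 'a" and t
    by (rule sum.mono_neutral_cong_left) auto
  have "f t + g t = (\<Sum>i<max d e. scale (t ^ i)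
      ((if i < d then v i else 0) + (if i < e then w i else 0)))" for t
    using pad[of t v d e] pad[of t w e d]
    by (simp only: f g scale_right_distrib sum.distrib max.commute[of e d])
  then show ?case by (intro exI allI)
next
  case (shift f)
  then obtain d v where f: "\<And>t. f t = (\<Sum>i<d. scale (t ^ i) (v i))"
    by blast
  have "scale t (f t) = (\<Sum>i<Suc d. scale (t ^ i) (case i of 0 \<Rightarrow> 0 | Suc j \<Rightarrow> v j))" for t
    unfolding f sum.lessThan_Suc_shift by (simp add: scale_sum_right)
  then show ?case by (intro exI allI)
qed

text \<open>For \<open>p(t)\<close> with \<open>d + 1\<close> coefficients, \<open>p(2 t) - 2^d p(t)\<close> has no term of degree \<open>d\<close>, while
  each lower coefficient is multiplied by a nonzero scalar. This gives an induction on the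
  number of coefficients without any Vandermonde determinant.\<close>

lemma vanishing_coefficients:
  assumes "\<And>t. (\<Sum>i<d. scale (t ^ i) (v i)) = 0" "i < d"
  shows "v i = 0"
  using assms
proof (induction d arbitrary: v i)
  case 0
  then show ?case by simp
next
  case (Suc d)
  have "(\<Sum>i<d. scale (t ^ i) (scale (2 ^ i - 2 ^ d) (v i))) = 0" for t
  proof -
    have "(\<Sum>i<Suc d. scale ((2 * t) ^ i) (v i))
        - scale (2 ^ d) (\<Sum>i<Suc d. scale (t ^ i) (v i)) = 0"
      by (simp only: Suc.prems(1) scale_zero_right diff_self)
    moreover have "(\<Sum>i<Suc d. scale ((2 * t) ^ i) (v i))
        - scale (2 ^ d) (\<Sum>i<Suc d. scale (t ^ i) (v i))
        = (\<Sum>i<Suc d. scale (t ^ i) (scale (2 ^ i - 2 ^ d) (v i)))"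
      unfolding scale_sum_right sum_subtractf[symmetric]
      by (intro sum.cong) (simp_all add: power_mult_distrib algebra_simps)
    ultimately show ?thesis by simp
  qed
  then have "scale (2 ^ j - 2 ^ d) (v j) = 0" if "j < d" for j
    using Suc.IH[of "\<lambda>i. scale (2 ^ i - 2 ^ d) (v i)" j] that by blast
  moreover have "(2::'k) ^ j - 2 ^ d \<noteq> 0" if "j < d" for j
  proof -
    have "(of_nat (2 ^ j) :: 'k) \<noteq> of_nat (2 ^ d)"
      using that by (subst of_nat_eq_iff) simp
    then show ?thesis by simp
  qed
  ultimately have low: "v j = 0" if "j < d" for j
    using that scale_eq_0_iff by blast
  have "v d = 0"
    using Suc.prems(1)[of 1] low by simp
  then show ?case
    using low Suc.prems(2) by (cases "i = d") auto
qed

definition jet :: "('k \<Rightarrow> 'a) \<Rightarrow> 'a \<Rightarrow> 'a \<Rightarrow> bool" where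
  "jet f a b \<longleftrightarrow> (\<exists>g. poly_curve g \<and> (\<forall>t. f t = a + scale t b + scale t (scale t (g t))))"

lemma jet_line: "jet (\<lambda>t. a + scale t b) a b"
  unfolding jet_def by (intro exI[of _ "\<lambda>t. 0"]) (simp add: poly_curve.const)

lemma jet_linear:
  assumes "Vector_Spaces.linear scale scale L" "jet f a b"
  shows "jet (\<lambda>t. L (f t)) (L a) (L b)"
proof -
  from assms(2) obtain g where "poly_curve g"
    and "\<And>t. f t = a + scale t b + scale t (scale t (g t))"
    unfolding jet_def by blast
  then show ?thesis
    unfolding jet_def using assms(1)
    by (intro exI[of _ "\<lambda>t. L (g t)"]) (auto simp: poly_curve_linear Vector_Spaces.linear_iff)
qed

lemma jet_bilinear:
  assumes left: "\<And>y. Vector_Spaces.linear scale scale (\<lambda>x. B x y)"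
    and right: "\<And>x. Vector_Spaces.linear scale scale (\<lambda>y. B x y)"
    and "jet f a b" "jet f' a' b'"
  shows "jet (\<lambda>t. B (f t) (f' t)) (B a a') (B a b' + B b a')"
proof -
  from assms(3) obtain g where g: "poly_curve g"
    and f: "\<And>t. f t = a + scale t b + scale t (scale t (g t))"
    unfolding jet_def by blast
  from assms(4) obtain g' where g': "poly_curve g'"
    and f': "\<And>t. f' t = a' + scale t b' + scale t (scale t (g' t))"
    unfolding jet_def by blast
  let ?r = "\<lambda>t. (B a (g' t) + (B (g t) a' + B b b'))
    + (scale t (B b (g' t) + B (g t) b') + scale t (scale t (B (g t) (g' t))))"
  have "poly_curve ?r"
    by (intro poly_curve.add poly_curve.shift poly_curve.const
        poly_curve_bilinear[OF left right g g']
        poly_curve_linear[OF left g] poly_curve_linear[OF right g'])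
  moreover have "B (f t) (f' t)
      = B a a' + scale t (B a b' + B b a') + scale t (scale t (?r t))" for t
  proof -
    have "B (u + v) w = B u w + B v w" "B (scale s u) w = scale s (B u w)"
      "B w (u + v) = B w u + B w v" "B w (scale s u) = scale s (B w u)" for u v w s
      using left right by (simp_all add: Vector_Spaces.linear_iff)
    then show ?thesis
      unfolding f f' by (simp add: scale_right_distrib ac_simps)
  qed
  ultimately show ?thesis
    unfolding jet_def by blast
qed

lemma jet_of_zero:
  assumes "jet f a b" "\<And>t. f t = 0"
  shows "b = 0"
proof -
  from assms(1) obtain g where "poly_curve g"
    and f: "\<And>t. f t = a + scale t b + scale t (scale t (g t))"
    unfolding jet_def by blast
  then obtain d v where g: "\<And>t. g t = (\<Sum>i<d. scale (t ^ i) (v i))"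
    using poly_curve_coefficients by blast
  let ?w = "case_nat a (case_nat b v)"
  have "(\<Sum>i<Suc (Suc d). scale (t ^ i) (?w i)) = f t" for t
    unfolding f g sum.lessThan_Suc_shift by (simp add: scale_sum_right ac_simps)
  then have "?w 1 = 0"
    using vanishing_coefficients[of ?w "Suc (Suc d)" 1] by (simp only: assms(2))
  then show ?thesis by simp
qed

end

section \<open>Linearising Hom-powers\<close>

lemma commutator_antisym: "commutator \<mu> b a = - commutator \<mu> a b"
  by (simp add: commutator_def)

locale char_0_hom_algebra = multiplicative_hom_algebra scale \<mu> \<alpha>
  for scale :: "'k::field_char_0 \<Rightarrow> 'a::ab_group_add \<Rightarrow> 'a" and \<mu> \<alpha>
begin

sublocale char_0_space scale ..

lemma alpha_pow_linear: "Vector_Spaces.linear scale scale (\<alpha> ^^ k)"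
  using alpha_linear by (induction k) (auto simp: Vector_Spaces.linear_iff)

lemma hom_power_alpha_pow:
  "hom_power \<mu> \<alpha> ((\<alpha> ^^ j) x) (Suc k) = (\<alpha> ^^ j) (hom_power \<mu> \<alpha> x (Suc k))"
proof (induction k)
  case (Suc k)
  have "(\<alpha> ^^ j) (\<mu> u v) = \<mu> ((\<alpha> ^^ j) u) ((\<alpha> ^^ j) v)" for u v
    by (induction j) (simp_all add: alpha_mult)
  with Suc show ?case
    by (simp add: funpow_add[symmetric, THEN fun_cong, unfolded o_apply] add.commute)
qed simp

lemma commutator_linear_left: "Vector_Spaces.linear scale scale (\<lambda>a. commutator \<mu> a b)"
  using mu_linear_left mu_linear_right
  by (simp add: Vector_Spaces.linear_iff commutator_def scale_right_diff_distrib)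

lemma commutator_linear_right: "Vector_Spaces.linear scale scale (\<lambda>b. commutator \<mu> a b)"
  using mu_linear_left mu_linear_right
  by (simp add: Vector_Spaces.linear_iff commutator_def scale_right_diff_distrib)

text \<open>Differentiating \<open>z^(k+2) = z^(k+1) \<alpha>^k(z)\<close> at \<open>z = \<alpha>^j(x)\<close> in the direction \<open>x^(j+1)\<close> gives two
  products: one is \<open>k + 1\<close> times the recursive definition of \<open>x^(k+j+2)\<close>, and the other is the
  splitting of \<open>x^(k+j+2)\<close> into exponents \<open>k + 1\<close> and \<open>j + 1\<close>. So the derivative behaves like that
  of an ordinary monomial.\<close>

lemma power_jet:
  assumes "up_to_hom_power_associative \<mu> \<alpha> N" "Suc (k + j) \<le> N"
  shows "jet (\<lambda>t. hom_power \<mu> \<alpha> ((\<alpha> ^^ j) x + scale t (hom_power \<mu> \<alpha> x (Suc j))) (Suc k))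
    ((\<alpha> ^^ j) (hom_power \<mu> \<alpha> x (Suc k)))
    (scale (of_nat (Suc k)) (hom_power \<mu> \<alpha> x (Suc (k + j))))"
  using assms(2)
proof (induction k)
  case 0
  show ?case by (simp add: jet_line)
next
  case (Suc k)
  let ?hp = "hom_power \<mu> \<alpha>"
  let ?z = "\<lambda>t. (\<alpha> ^^ j) x + scale t (?hp x (Suc j))"
  have "jet (\<lambda>t. \<mu> (?hp (?z t) (Suc k)) ((\<alpha> ^^ k) (?z t)))
    (\<mu> ((\<alpha> ^^ j) (?hp x (Suc k))) ((\<alpha> ^^ k) ((\<alpha> ^^ j) x)))
    (\<mu> ((\<alpha> ^^ j) (?hp x (Suc k))) ((\<alpha> ^^ k) (?hp x (Suc j)))
      + \<mu> (scale (of_nat (Suc k)) (?hp x (Suc (k + j)))) ((\<alpha> ^^ k) ((\<alpha> ^^ j) x)))"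
    using Suc
    by (intro jet_bilinear[OF mu_linear_left mu_linear_right]
        jet_linear[OF alpha_pow_linear] jet_line) simp
  moreover have "\<mu> ((\<alpha> ^^ j) (?hp x (Suc k))) ((\<alpha> ^^ k) ((\<alpha> ^^ j) x))
      = (\<alpha> ^^ j) (?hp x (Suc (Suc k)))"
    using hom_power_alpha_pow[of j x "Suc k"] hom_power_alpha_pow[of j x k] by simp
  moreover have "\<mu> ((\<alpha> ^^ j) (?hp x (Suc k))) ((\<alpha> ^^ k) (?hp x (Suc j)))
      = ?hp x (Suc (Suc (k + j)))"
  proof -
    have "hom_power_associative \<mu> \<alpha> (Suc (Suc (k + j)))"
      using assms(1) Suc.prems by (simp add: up_to_hom_power_associative_def)
    then show ?thesis
      unfolding hom_power_associative_def
      by (elim allE[of _ x] ballE[of _ _ "Suc k"]) (simp_all del: hom_power.simps)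
  qed
  moreover have "\<mu> (scale (of_nat (Suc k)) (?hp x (Suc (k + j)))) ((\<alpha> ^^ k) ((\<alpha> ^^ j) x))
      = scale (of_nat (Suc k)) (?hp x (Suc (Suc (k + j))))"
    using mu_linear_left by (simp add: Vector_Spaces.linear_iff funpow_add)
  moreover have "v + scale (of_nat (Suc k)) v = scale (of_nat (Suc (Suc k))) v" for v
    by (simp only: of_nat_Suc[of "Suc k"] scale_left_distrib scale_one)
  ultimately show ?case
    by (simp del: of_nat_Suc)
qed

lemma commutation_of_associativity:
  assumes "hom_power_associative \<mu> \<alpha> (Suc (Suc k))"
  shows "commutator \<mu> (hom_power \<mu> \<alpha> z (Suc k)) ((\<alpha> ^^ k) z) = 0"
proof -
  have "hom_power \<mu> \<alpha> z (Suc (Suc k)) = \<mu> ((\<alpha> ^^ k) z) (hom_power \<mu> \<alpha> z (Suc k))"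
    using assms[unfolded hom_power_associative_def, rule_format, of 1 z] by simp
  then show ?thesis by (simp add: commutator_def)
qed

text \<open>The hypothesis \<open>j \<ge> 1\<close> keeps the degree \<open>k + 2\<close> of the linearised identity strictly below the
  degree \<open>k + j + 2\<close> of the result.\<close>

lemma linearized_commutation:
  assumes "up_to_hom_power_associative \<mu> \<alpha> (Suc (k + j))" "j \<ge> 1"
  shows "commutator \<mu> ((\<alpha> ^^ j) (hom_power \<mu> \<alpha> x (Suc k))) ((\<alpha> ^^ k) (hom_power \<mu> \<alpha> x (Suc j)))
    = - scale (of_nat (Suc k))
        (commutator \<mu> (hom_power \<mu> \<alpha> x (Suc (k + j))) ((\<alpha> ^^ (k + j)) x))"
proof -
  let ?hp = "hom_power \<mu> \<alpha>"
  let ?z = "\<lambda>t. (\<alpha> ^^ j) x + scale t (?hp x (Suc j))"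
  have "hom_power_associative \<mu> \<alpha> (Suc (Suc k))"
    using assms by (simp add: up_to_hom_power_associative_def)
  then have zero: "commutator \<mu> (?hp (?z t) (Suc k)) ((\<alpha> ^^ k) (?z t)) = 0" for t
    by (rule commutation_of_associativity)
  have "jet (\<lambda>t. commutator \<mu> (?hp (?z t) (Suc k)) ((\<alpha> ^^ k) (?z t)))
    (commutator \<mu> ((\<alpha> ^^ j) (?hp x (Suc k))) ((\<alpha> ^^ k) ((\<alpha> ^^ j) x)))
    (commutator \<mu> ((\<alpha> ^^ j) (?hp x (Suc k))) ((\<alpha> ^^ k) (?hp x (Suc j)))
      + commutator \<mu> (scale (of_nat (Suc k)) (?hp x (Suc (k + j)))) ((\<alpha> ^^ k) ((\<alpha> ^^ j) x)))"
    by (intro jet_bilinear[OF commutator_linear_left commutator_linear_right]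
        jet_linear[OF alpha_pow_linear] jet_line power_jet[OF assms(1)]) simp
  from jet_of_zero[OF this zero]
  have "commutator \<mu> ((\<alpha> ^^ j) (?hp x (Suc k))) ((\<alpha> ^^ k) (?hp x (Suc j)))
      + scale (of_nat (Suc k)) (commutator \<mu> (?hp x (Suc (k + j))) ((\<alpha> ^^ (k + j)) x)) = 0"
    using commutator_linear_left by (simp add: Vector_Spaces.linear_iff funpow_add del: of_nat_Suc)
  then show ?thesis by (simp only: eq_neg_iff_add_eq_0)
qed

section \<open>Vanishing of the commutators\<close>

text \<open>The exponents are written \<open>p + 1\<close> and \<open>q + 1\<close>, so that the total degree is \<open>p + q + 2\<close> and the
  exchange of \<open>p\<close> and \<open>q\<close> reverses the sign. The pairs \<open>(m, 1)\<close> and \<open>(1, m)\<close> give two values of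
  the same commutator, as multiples of the one for \<open>(m + 1, 0)\<close>; comparing them annihilates the
  latter.\<close>

theorem hom_power_commutator:
  assumes assoc: "up_to_hom_power_associative \<mu> \<alpha> (Suc (p + q))" and "p + q \<ge> 2"
  shows "commutator \<mu> ((\<alpha> ^^ q) (hom_power \<mu> \<alpha> x (Suc p)))
    ((\<alpha> ^^ p) (hom_power \<mu> \<alpha> x (Suc q))) = 0"
proof -
  let ?c = "\<lambda>p q. commutator \<mu> ((\<alpha> ^^ q) (hom_power \<mu> \<alpha> x (Suc p)))
    ((\<alpha> ^^ p) (hom_power \<mu> \<alpha> x (Suc q)))"
  define m where "m = p + q - 1"
  have m: "p + q = Suc m" "m \<ge> 1" using assms(2) by (auto simp: m_def)
  let ?C = "?c (Suc m) 0"
  have reduce: "?c k j = - scale (of_nat (Suc k)) ?C" if "k + j = Suc m" "j \<ge> 1" for k j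
    using linearized_commutation[of k j x] assoc that m by simp
  have "?c m 1 = - scale (of_nat (Suc m)) ?C" "?c 1 m = - scale (of_nat 2) ?C"
    using reduce[of m 1] reduce[of 1 m] m(2) by simp_all
  moreover have "?c 1 m = - ?c m 1" by (rule commutator_antisym)
  ultimately have "scale (of_nat 2) ?C + scale (of_nat (Suc m)) ?C = 0"
    by (metis add.right_inverse minus_minus)
  then have "scale (of_nat (2 + Suc m)) ?C = 0"
    by (simp only: scale_left_distrib of_nat_add)
  then have C: "?C = 0"
    using scale_eq_0_iff of_nat_eq_0_iff by (metis add_is_0 nat.distinct(1))
  show ?thesis
  proof (cases "q = 0")
    case True
    then show ?thesis using C m by simp
  next
    case False
    then show ?thesis using reduce[of p q] C m by simp
  qed
qed

end

theorem proposition3p4: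
  fixes scale :: "'k::field_char_0 \<Rightarrow> 'a::ab_group_add \<Rightarrow> 'a"
    and \<mu> :: "'a \<Rightarrow> 'a \<Rightarrow> 'a" and \<alpha> :: "'a \<Rightarrow> 'a"
    and n l :: nat and x :: 'a
  assumes "multiplicative_hom_algebra scale \<mu> \<alpha>"
    and "n \<ge> 4"
    and "up_to_hom_power_associative \<mu> \<alpha> (n - 1)"
    and "l \<in> {1..n-1}"
  shows "commutator \<mu> ((\<alpha> ^^ (l - 1)) (hom_power \<mu> \<alpha> x (n - l)))
           ((\<alpha> ^^ (n - l - 1)) (hom_power \<mu> \<alpha> x l)) = 0"
proof -
  interpret char_0_hom_algebra scale \<mu> \<alpha>
    using assms(1) by (rule char_0_hom_algebra.intro)
  have "Suc (n - l - 1 + (l - 1)) = n - 1" "Suc (n - l - 1) = n - l" "Suc (l - 1) = l"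
    using assms(2,4) by auto
  then show ?thesis
    using hom_power_commutator[of "n - l - 1" "l - 1" x] assms(2,3) by simp
qed

end
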